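(* Let $S$ be an intra-regular AG-groupoid with left identity and let $A=(\mu_A,\gamma_A)$ be an intuitionistic fuzzy set of $S$. Then the following conditions are equivalent: (i) $A$ is an intuitionistic fuzzy two-sided ideal of $S$; (ii) $A$ is an intuitionistic fuzzy bi-ideal of $S$.
   Context: An AG-groupoid is a non-empty set $S$ with a binary operation satisfying the left invertive law $(ab)c=(cb)a$ for all $a,b,c\in S$ (no associativity is assumed); $a^2$ denotes $aa$. A left identity is an element $e\in S$ with $ea=a$ for all $a\in S$. $S$ is intra-regular if for every $a\in S$ there are $x,y\in S$ with $a=(xa^2)y$. An intuitionistic fuzzy set (IFS) of $S$ is a pair $A=(\mu_A,\gamma_A)$ of functions $\mu_A,\gamma_A:S\to[0,1]$ with $0\le \mu_A(x)+\gamma_A(x)\le 1$ for all $x\in S$. An IFS $A$ is an intuitionistic fuzzy left ideal if $\mu_A(xy)\ge\mu_A(y)$ and $\gamma_A(xy)\le\gamma_A(y)$ for all $x,y\in S$; an intuitionistic fuzzy right ideal if $\mu_A(xy)\ge\mu_A(x)$ and $\gamma_A(xy)\le\gamma_A(x)$ for all $x,y\in S$; an intuitionistic fuzzy two-sided ideal if it is both. It is an intuitionistic fuzzy AG-subgroupoid if $\mu_A(xy)\ge\min\{\mu_A(x),\mu_A(y)\}$ and $\gamma_A(xy)\le\max\{\gamma_A(x),\gamma_A(y)\}$ for all $x,y\in S$. An intuitionistic fuzzy bi-ideal is an intuitionistic fuzzy AG-subgroupoid with $\mu_A((xa)y)\ge\min\{\mu_A(x),\mu_A(y)\}$ and $\gamma_A((xa)y)\le\max\{\gamma_A(x),\gamma_A(y)\}$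 for all $x,a,y\in S$. *)

theory Defs
  imports Complex_Main
begin

text \<open>
  An AG-groupoid is a carrier set together with a binary operation. Fuzzy components are total
  real-valued functions, but every condition is imposed on the carrier only, so their
  values outside it are irrelevant.
\<close>

definition ag_groupoid :: "'a set \<Rightarrow> ('a \<Rightarrow> 'a \<Rightarrow> 'a) \<Rightarrow> bool" where
  "ag_groupoid S m \<longleftrightarrow>
     S \<noteq> {} \<and>
     (\<forall>a\<in>S. \<forall>b\<in>S. m a b \<in> S) \<and>
     (\<forall>a\<in>S. \<forall>b\<in>S. \<forall>c\<in>S. m (m a b) c = m (m c b) a)"

definition left_identity :: "'a set \<Rightarrow> ('a \<Rightarrow> 'a \<Rightarrow> 'a) \<Rightarrow> 'a \<Rightarrow> bool" where
  "left_identity S m e \<longleftrightarrow> e \<in> S \<and> (\<forall>a\<in>S. m e a = a)"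

definition intra_regular :: "'a set \<Rightarrow> ('a \<Rightarrow> 'a \<Rightarrow> 'a) \<Rightarrow> bool" where
  "intra_regular S m \<longleftrightarrow> (\<forall>a\<in>S. \<exists>x\<in>S. \<exists>y\<in>S. a = m (m x (m a a)) y)"

type_synonym 'a ifs = "('a \<Rightarrow> real) \<times> ('a \<Rightarrow> real)"

abbreviation membership :: "'a ifs \<Rightarrow> 'a \<Rightarrow> real" ("\<mu>") where
  "\<mu> A \<equiv> fst A"

abbreviation nonmembership :: "'a ifs \<Rightarrow> 'a \<Rightarrow> real" ("\<gamma>") where
  "\<gamma> A \<equiv> snd A"

definition int_fuzzy_set :: "'a set \<Rightarrow> 'a ifs \<Rightarrow> bool" where
  "int_fuzzy_set S A \<longleftrightarrow>
     (\<forall>x\<in>S. \<mu> A x \<in> {0..1} \<and> \<gamma> A x \<in> {0..1} \<and>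
        0 \<le> \<mu> A x + \<gamma> A x \<and> \<mu> A x + \<gamma> A x \<le> 1)"

definition int_fuzzy_left_ideal :: "'a set \<Rightarrow> ('a \<Rightarrow> 'a \<Rightarrow> 'a) \<Rightarrow> 'a ifs \<Rightarrow> bool" where
  "int_fuzzy_left_ideal S m A \<longleftrightarrow>
     int_fuzzy_set S A \<and>
     (\<forall>x\<in>S. \<forall>y\<in>S. \<mu> A (m x y) \<ge> \<mu> A y \<and> \<gamma> A (m x y) \<le> \<gamma> A y)"

definition int_fuzzy_right_ideal :: "'a set \<Rightarrow> ('a \<Rightarrow> 'a \<Rightarrow> 'a) \<Rightarrow> 'a ifs \<Rightarrow> bool" where
  "int_fuzzy_right_ideal S m A \<longleftrightarrow>
     int_fuzzy_set S A \<and>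
     (\<forall>x\<in>S. \<forall>y\<in>S. \<mu> A (m x y) \<ge> \<mu> A x \<and> \<gamma> A (m x y) \<le> \<gamma> A x)"

definition int_fuzzy_two_sided_ideal :: "'a set \<Rightarrow> ('a \<Rightarrow> 'a \<Rightarrow> 'a) \<Rightarrow> 'a ifs \<Rightarrow> bool" where
  "int_fuzzy_two_sided_ideal S m A \<longleftrightarrow>
     int_fuzzy_left_ideal S m A \<and> int_fuzzy_right_ideal S m A"

definition int_fuzzy_ag_subgroupoid :: "'a set \<Rightarrow> ('a \<Rightarrow> 'a \<Rightarrow> 'a) \<Rightarrow> 'a ifs \<Rightarrow> bool" where
  "int_fuzzy_ag_subgroupoid S m A \<longleftrightarrow>
     int_fuzzy_set S A \<and>
     (\<forall>x\<in>S. \<forall>y\<in>S. \<mu> A (m x y) \<ge> min (\<mu> A x) (\<mu> A y) \<and>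
        \<gamma> A (m x y) \<le> max (\<gamma> A x) (\<gamma> A y))"

definition int_fuzzy_bi_ideal :: "'a set \<Rightarrow> ('a \<Rightarrow> 'a \<Rightarrow> 'a) \<Rightarrow> 'a ifs \<Rightarrow> bool" where
  "int_fuzzy_bi_ideal S m A \<longleftrightarrow>
     int_fuzzy_ag_subgroupoid S m A \<and>
     (\<forall>x\<in>S. \<forall>a\<in>S. \<forall>y\<in>S. \<mu> A (m (m x a) y) \<ge> min (\<mu> A x) (\<mu> A y) \<and>
        \<gamma> A (m (m x a) y) \<le> max (\<gamma> A x) (\<gamma> A y))"

end

theory Submission
  imports Defs
begin

text \<open>
  With a left identity, the left invertive law yields the medial and paramedial laws and
  \<open>a(bc) = b(ac)\<close>. Intra-regularity of \<open>x\<close> puts both \<open>xy\<close> and \<open>yx\<close> into \<open>Sx\<^sup>2\<close>, and intra-regularity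
  of \<open>b = x\<^sup>2\<close> puts \<open>Sb\<close> into \<open>(bS)b\<close>. Hence the bi-ideal inequalities bound the value at
  \<open>xy\<close> and at \<open>yx\<close> by the value at \<open>x\<^sup>2\<close>, which in turn is bounded by the value at \<open>x\<close>.
\<close>

locale ag_groupoid_left_identity =
  fixes S :: "'a set" and m :: "'a \<Rightarrow> 'a \<Rightarrow> 'a" (infixl "\<cdot>" 70) and e :: 'a
  assumes ag: "ag_groupoid S m" and left_id: "left_identity S m e"
begin

lemma closed [simp, intro]: "a \<in> S \<Longrightarrow> b \<in> S \<Longrightarrow> a \<cdot> b \<in> S"
  using ag by (auto simp: ag_groupoid_def)

lemma left_invertive: "a \<in> S \<Longrightarrow> b \<in> S \<Longrightarrow> c \<in> S \<Longrightarrow> (a \<cdot> b) \<cdot> c = (c \<cdot> b) \<cdot> a"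
  using ag unfolding ag_groupoid_def by blast

lemma identity_closed [simp, intro]: "e \<in> S"
  using left_id by (auto simp: left_identity_def)

lemma identity_mult [simp]: "a \<in> S \<Longrightarrow> e \<cdot> a = a"
  using left_id by (auto simp: left_identity_def)

lemma medial:
  assumes "a \<in> S" "b \<in> S" "c \<in> S" "d \<in> S"
  shows "(a \<cdot> b) \<cdot> (c \<cdot> d) = (a \<cdot> c) \<cdot> (b \<cdot> d)"
proof -
  have "(a \<cdot> b) \<cdot> (c \<cdot> d) = ((c \<cdot> d) \<cdot> b) \<cdot> a"
    using assms by (intro left_invertive) auto
  also have "(c \<cdot> d) \<cdot> b = (b \<cdot> d) \<cdot> c"
    using assms by (intro left_invertive) auto
  also have "((b \<cdot> d) \<cdot> c) \<cdot> a = (a \<cdot> c) \<cdot> (b \<cdot> d)"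
    using assms by (intro left_invertive) auto
  finally show ?thesis .
qed

lemma left_commute:
  assumes "a \<in> S" "b \<in> S" "c \<in> S"
  shows "a \<cdot> (b \<cdot> c) = b \<cdot> (a \<cdot> c)"
  using medial[of e a b c] assms by simp

text \<open>Writing \<open>a\<close> as \<open>e \<cdot> a\<close> lets the medial law bring
  \<open>e\<close> to the right of \<open>c \<cdot> d\<close>, where left invertivity turns
  \<open>(c \<cdot> d) \<cdot> e\<close> into \<open>d \<cdot> c\<close>. The result is the usual
  paramedial law followed by the medial one.\<close>

lemma paramedial_swap:
  assumes "a \<in> S" "b \<in> S" "c \<in> S" "d \<in> S"
  shows "(a \<cdot> b) \<cdot> (c \<cdot> d) = (d \<cdot> c) \<cdot> (b \<cdot> a)"
proof -
  have "(a \<cdot> b) \<cdot> (c \<cdot> d) = ((c \<cdot> d) \<cdot> b) \<cdot> a"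
    using assms by (intro left_invertive) auto
  also have "\<dots> = ((c \<cdot> d) \<cdot> b) \<cdot> (e \<cdot> a)"
    using assms by simp
  also have "\<dots> = ((c \<cdot> d) \<cdot> e) \<cdot> (b \<cdot> a)"
    using assms by (intro medial) auto
  also have "(c \<cdot> d) \<cdot> e = (e \<cdot> d) \<cdot> c"
    using assms by (intro left_invertive) auto
  finally show ?thesis
    using assms by simp
qed

text \<open>Reversing all four factors leaves a square unchanged, so a square passes across any
  factor; since \<open>e\<close> is only a left identity, the price is a factor \<open>e\<close> on
  the right.\<close>

lemma mult_square_eq:
  assumes "s \<in> S" "x \<in> S"
  shows "s \<cdot> (x \<cdot> x) = (x \<cdot> x) \<cdot> (s \<cdot> e)"
  using paramedial_swap[of e s x x] assms by simp

lemma square_mult_eq: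
  assumes "q \<in> S" "x \<in> S"
  shows "(x \<cdot> x) \<cdot> q = (q \<cdot> e) \<cdot> (x \<cdot> x)"
  using paramedial_swap[of x x e q] assms by simp

text \<open>This extracts a square from a product as its left factor. It is used for an arbitrary
  \<open>y\<close> and later for a \<open>y\<close> that is itself a square.\<close>

lemma mult_intra_regular:
  assumes "u \<in> S" "v \<in> S" "x \<in> S" "y \<in> S" and y: "y = (u \<cdot> (y \<cdot> y)) \<cdot> v"
  shows "x \<cdot> y = (y \<cdot> y) \<cdot> ((v \<cdot> x) \<cdot> u)"
proof -
  have "x \<cdot> y = x \<cdot> ((u \<cdot> (y \<cdot> y)) \<cdot> v)"
    using y by simp
  also have "\<dots> = (u \<cdot> (y \<cdot> y)) \<cdot> (x \<cdot> v)"
    using assms(1-4) by (intro left_commute) auto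
  also have "\<dots> = (v \<cdot> x) \<cdot> ((y \<cdot> y) \<cdot> u)"
    using assms(1-4) by (intro paramedial_swap) auto
  also have "\<dots> = (y \<cdot> y) \<cdot> ((v \<cdot> x) \<cdot> u)"
    using assms(1-4) by (intro left_commute) auto
  finally show ?thesis .
qed

context
  assumes ir: "intra_regular S m"
begin

lemma intra_regularE:
  assumes "a \<in> S"
  obtains u v where "u \<in> S" "v \<in> S" "a = (u \<cdot> (a \<cdot> a)) \<cdot> v"
  using ir assms unfolding intra_regular_def by blast

lemma mult_eq_mult_square_right:
  assumes "x \<in> S" "y \<in> S"
  shows "\<exists>s\<in>S. x \<cdot> y = s \<cdot> (y \<cdot> y)"
proof -
  obtain u v where "u \<in> S" "v \<in> S" "y = (u \<cdot> (y \<cdot> y)) \<cdot> v"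
    using intra_regularE[OF assms(2)] .
  with assms have "x \<cdot> y = (((v \<cdot> x) \<cdot> u) \<cdot> e) \<cdot> (y \<cdot> y)"
    using mult_intra_regular[of u v x y] square_mult_eq[of "(v \<cdot> x) \<cdot> u" y] by simp
  with \<open>u \<in> S\<close> \<open>v \<in> S\<close> assms show ?thesis
    by blast
qed

lemma mult_eq_mult_square_left:
  assumes "x \<in> S" "y \<in> S"
  shows "\<exists>s\<in>S. x \<cdot> y = s \<cdot> (x \<cdot> x)"
proof -
  obtain u v where uv: "u \<in> S" "v \<in> S" and x: "x = (u \<cdot> (x \<cdot> x)) \<cdot> v"
    using intra_regularE[OF assms(1)] .
  have "x \<cdot> y = ((u \<cdot> (x \<cdot> x)) \<cdot> v) \<cdot> y"
    using x by simp
  also have "\<dots> = (y \<cdot> v) \<cdot> (u \<cdot> (x \<cdot> x))"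
    using uv assms by (intro left_invertive) auto
  \<comment> \<open>The square has to stand on the left of the inner product before
    \<open>left_commute\<close> can pull it out.\<close>
  also have "\<dots> = (y \<cdot> v) \<cdot> ((x \<cdot> x) \<cdot> (u \<cdot> e))"
    using uv assms mult_square_eq[of u x] by simp
  also have "\<dots> = (x \<cdot> x) \<cdot> ((y \<cdot> v) \<cdot> (u \<cdot> e))"
    using uv assms by (intro left_commute) auto
  also have "\<dots> = (((y \<cdot> v) \<cdot> (u \<cdot> e)) \<cdot> e) \<cdot> (x \<cdot> x)"
    using uv assms by (intro square_mult_eq) auto
  finally show ?thesis
    using uv assms by blast
qed

lemma mult_square_eq_sandwich:
  assumes "s \<in> S" "x \<in> S"
  shows "\<exists>a\<in>S. s \<cdot> (x \<cdot> x) = ((x \<cdot> x) \<cdot> a) \<cdot> (x \<cdot> x)"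
proof -
  define b where "b = x \<cdot> x"
  have b: "b \<in> S"
    using assms by (simp add: b_def)
  \<comment> \<open>Intra-regularity is applied to the square \<open>b\<close>, not to
    \<open>x\<close>: this produces \<open>b \<cdot> b\<close>, one copy of \<open>b\<close> for
    each end of the sandwich.\<close>
  obtain u v where uv: "u \<in> S" "v \<in> S" and eq: "b = (u \<cdot> (b \<cdot> b)) \<cdot> v"
    using intra_regularE[OF b] .
  define q where "q = (v \<cdot> s) \<cdot> u"
  have q: "q \<in> S"
    using uv assms by (simp add: q_def)
  have "s \<cdot> b = (b \<cdot> b) \<cdot> q"
    unfolding q_def using uv assms(1) b eq by (intro mult_intra_regular)
  also have "\<dots> = (q \<cdot> b) \<cdot> b"
    using b q by (intro left_invertive)
  \<comment> \<open>Here it matters that \<open>b\<close> is a square; the middle factor sought is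
    \<open>q \<cdot> e\<close>.\<close>
  also have "q \<cdot> b = b \<cdot> (q \<cdot> e)"
    unfolding b_def using q assms(2) by (intro mult_square_eq)
  finally show ?thesis
    using q unfolding b_def by blast
qed

text \<open>Stated for a single function into a linear order, so that it serves both for
  \<open>\<mu> A\<close> and for the negative of \<open>\<gamma> A\<close>.\<close>

lemma bi_ideal_le_mult:
  fixes f :: "'a \<Rightarrow> 'b::linorder"
  assumes sub: "\<And>x y. x \<in> S \<Longrightarrow> y \<in> S \<Longrightarrow> min (f x) (f y) \<le> f (x \<cdot> y)"
    and bi: "\<And>x a y. x \<in> S \<Longrightarrow> a \<in> S \<Longrightarrow> y \<in> S \<Longrightarrow> min (f x) (f y) \<le> f ((x \<cdot> a) \<cdot> y)"
    and xy: "x \<in> S" "y \<in> S"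
  shows "f x \<le> f (x \<cdot> y)" and "f y \<le> f (x \<cdot> y)"
proof -
  have square: "f z \<le> f (s \<cdot> (z \<cdot> z))" if sz: "s \<in> S" "z \<in> S" for s z
  proof -
    obtain a where "a \<in> S" and eq: "s \<cdot> (z \<cdot> z) = ((z \<cdot> z) \<cdot> a) \<cdot> (z \<cdot> z)"
      using mult_square_eq_sandwich[OF sz] by blast
    have "f z \<le> f (z \<cdot> z)"
      using sub[of z z] sz by simp
    also have "\<dots> \<le> f (s \<cdot> (z \<cdot> z))"
      using bi[of "z \<cdot> z" a "z \<cdot> z"] \<open>a \<in> S\<close> sz by (simp add: eq)
    finally show ?thesis .
  qed
  show "f x \<le> f (x \<cdot> y)"
    using mult_eq_mult_square_left[OF xy] square xy by fastforce
  show "f y \<le> f (x \<cdot> y)"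
    using mult_eq_mult_square_right[OF xy] square xy by fastforce
qed

end

end

theorem theorem13:
  fixes S :: "'a set" and m :: "'a \<Rightarrow> 'a \<Rightarrow> 'a" and A :: "'a ifs"
  assumes "ag_groupoid S m"
    and "\<exists>e. left_identity S m e"
    and "intra_regular S m"
    and "int_fuzzy_set S A"
  shows "int_fuzzy_two_sided_ideal S m A \<longleftrightarrow> int_fuzzy_bi_ideal S m A"
proof
  assume "int_fuzzy_two_sided_ideal S m A"
  moreover have "m x y \<in> S" if "x \<in> S" "y \<in> S" for x y
    using assms(1) that by (auto simp: ag_groupoid_def)
  \<comment> \<open>The left-ideal inequalities compare a product with its last factor
    \<open>y\<close>, and the value at \<open>y\<close> is at least the minimum and at most the
    maximum. Closure gives \<open>m x a \<in> S\<close> for the triple product.\<close>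
  ultimately show "int_fuzzy_bi_ideal S m A"
    by (simp add: int_fuzzy_two_sided_ideal_def int_fuzzy_left_ideal_def
        int_fuzzy_bi_ideal_def int_fuzzy_ag_subgroupoid_def min.coboundedI2 max.coboundedI2)
next
  assume bi: "int_fuzzy_bi_ideal S m A"
  obtain e where "left_identity S m e"
    using assms(2) by blast
  then interpret ag_groupoid_left_identity S m e
    using assms(1) by unfold_locales
  have mu: "\<mu> A x \<le> \<mu> A (m x y)" "\<mu> A y \<le> \<mu> A (m x y)" if "x \<in> S" "y \<in> S" for x y
    using bi that by (auto intro!: bi_ideal_le_mult[OF assms(3), of "\<mu> A"]
        simp: int_fuzzy_bi_ideal_def int_fuzzy_ag_subgroupoid_def)
  \<comment> \<open>Negation turns the upper bounds by a maximum into lower bounds by a minimum, as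
    \<open>bi_ideal_le_mult\<close> requires.\<close>
  have "min (- \<gamma> A x) (- \<gamma> A y) \<le> - \<gamma> A (m x y)" if "x \<in> S" "y \<in> S" for x y
    using bi that by (simp add: int_fuzzy_bi_ideal_def int_fuzzy_ag_subgroupoid_def
        flip: minus_max_eq_min)
  moreover have "min (- \<gamma> A x) (- \<gamma> A y) \<le> - \<gamma> A (m (m x a) y)"
    if "x \<in> S" "a \<in> S" "y \<in> S" for x a y
    using bi that by (simp add: int_fuzzy_bi_ideal_def flip: minus_max_eq_min)
  ultimately have ga: "- \<gamma> A x \<le> - \<gamma> A (m x y)" "- \<gamma> A y \<le> - \<gamma> A (m x y)"
    if "x \<in> S" "y \<in> S" for x y
    using bi_ideal_le_mult[OF assms(3), of "\<lambda>z. - \<gamma> A z", OF _ _ that] by blast+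
  show "int_fuzzy_two_sided_ideal S m A"
    using mu ga assms(4) by (simp add: int_fuzzy_two_sided_ideal_def
        int_fuzzy_left_ideal_def int_fuzzy_right_ideal_def)
qed

end
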